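(* Let $p$ be a prime, $K$ a finite extension of $\mathbb{Q}_p$ with valuation ring $R$, and let $G$ be an $m$-dimensional formal group law over $R$. For $k\geq 0$ let $\mathcal{G}(k)$ be the $m$-standard group of level $k$ to $G$ and let $\mathcal{O}_c(\mathcal{G}(k))$ be the ring of convergent functions on $\mathcal{G}(k)$. Let $h\ge0$, let $G_h$ be the formal group law associated to $G$ and $h$, and let $$\tilde{\mathcal{O}}(G_h)=\Big\{\sum_{\underline j}b_{\underline j}(p^{-h}\underline t)^{\underline j}\in K[[p^{-h}\underline t]] : \underline j!\,b_{\underline j}\in R\Big\}$$ be its modified ring of functions. Then $\tilde{\mathcal{O}}(G_h)\subset\mathcal{O}_c(\mathcal{G}(k))$ for all $k>k_0=h+\frac{1}{p-1}$.
   Context: $|\cdot|$ is the absolute value on $K$ with $|p|=p^{-1}$; $R=\{x\in K:|x|\le1\}$; max norm on $K^m$; $\underline t=(t^{(1)},\dots,t^{(m)})$, $\underline j!=j_1!\cdots j_m!$, $|\underline j|=j_1+\dots+j_m$. An $m$-dimensional formal group law over $R$ is an $m$-tuple $G$ of power series in $R[[\mathbf{X},\mathbf{Y}]]$ with $G^{(j)}(\mathbf{X},\mathbf{Y})=X_j+Y_j+\sum_{l,k}\gamma^j_{lk}X_lY_k+(\text{total degree}\ge3)$ and $G(G(\mathbf{X},\mathbf{Y}),\mathbf{Z})=G(\mathbf{X},G(\mathbf{Y},\mathbf{Z}))$. The standard group $\mathcal{G}(k)$ is $\{z\in R^m:|z|<p^{-k}\}$ with multiplication $z_1\cdot z_2=G(z_1,z_2)$.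 The formal group law $G_h$ is $G_h(\mathbf{X},\mathbf{Y})=p^{-h}G(p^h\mathbf{X},p^h\mathbf{Y})$, whose ring of functions is $R[[p^{-h}\underline t]]$. $\mathcal{O}_c(\mathcal{G}(k))$ is the set of formal power series in $R[[p^{-k}\underline t]]$ which converge on the closed polydisc $\{z\in K^m:|z|\le p^{-k}\}$. All these rings are regarded inside $K[[\underline t]]$: $\sum c_{\underline j}\underline t^{\underline j}\in R[[p^{-k}\underline t]]$ means $|c_{\underline j}|\,p^{-k|\underline j|}\le1$ for all $\underline j$, and $\sum c_{\underline j}\underline t^{\underline j}\in\tilde{\mathcal{O}}(G_h)$ means $|\underline j!\,c_{\underline j}|\,p^{-h|\underline j|}\le1$ for all $\underline j$; this gives a meaning to the notation also for non-integral $h$, $k$ (the formal group law $G_h$ itself requires $p^h\in K$). *)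

theory Defs
  imports "HOL-Analysis.Analysis" "HOL-Computational_Algebra.Primes"
begin

section \<open>Formal power series in finitely many variables\<close>

typedef ('v, 'a) mps = "UNIV :: (('v \<Rightarrow> nat) \<Rightarrow> 'a) set"
  morphisms mps_nth Abs_mps ..

lemma mps_nth_Abs [simp]: "mps_nth (Abs_mps f) = f"
  by (simp add: Abs_mps_inverse)

lemma mps_ext: "(\<And>n. mps_nth f n = mps_nth g n) \<Longrightarrow> f = g"
  by (metis ext mps_nth_inverse)

definition mdeg :: "('v::finite \<Rightarrow> nat) \<Rightarrow> nat" where
  "mdeg j = (\<Sum>i\<in>UNIV. j i)"

lemma finite_atMost_index: "finite {..n :: 'v::finite \<Rightarrow> nat}"
proof -
  have "{..n} = PiE UNIV (\<lambda>i. {..n i})"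
    by (auto simp: le_fun_def PiE_def Pi_def)
  then show ?thesis by (simp add: finite_PiE)
qed

lemma finite_mdeg_le: "finite {j :: 'v::finite \<Rightarrow> nat. mdeg j \<le> N}"
proof (rule finite_subset)
  show "{j :: 'v \<Rightarrow> nat. mdeg j \<le> N} \<subseteq> {..(\<lambda>_. N)}"
  proof
    fix j :: "'v \<Rightarrow> nat" assume "j \<in> {j. mdeg j \<le> N}"
    moreover have "j i \<le> mdeg j" for i
      unfolding mdeg_def by (rule member_le_sum) auto
    ultimately show "j \<in> {..(\<lambda>_. N)}"
      by (auto simp: le_fun_def intro: order_trans)
  qed
qed (rule finite_atMost_index)

instantiation mps :: (finite, comm_ring_1) comm_ring_1
begin

definition "0 = Abs_mps (\<lambda>_. 0)"
definition "1 = Abs_mps (\<lambda>n. if n = (\<lambda>_. 0) then 1 else 0)"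
definition "f + g = Abs_mps (\<lambda>n. mps_nth f n + mps_nth g n)"
definition "- f = Abs_mps (\<lambda>n. - mps_nth f n)"
definition "f - g = Abs_mps (\<lambda>n. mps_nth f n - mps_nth g n)"
definition "f * g = Abs_mps (\<lambda>n. \<Sum>a\<in>{..n}. mps_nth f a * mps_nth g (n - a))"

instance
proof
  fix f g h :: "('a, 'b) mps"
  show "f * g * h = f * (g * h)"
  proof (rule mps_ext)
    fix n :: "'a \<Rightarrow> nat"
    have "mps_nth (f * g * h) n =
        (\<Sum>(a, b)\<in>(SIGMA a:{..n}. {..a}). mps_nth f b * mps_nth g (a - b) * mps_nth h (n - a))"
      by (simp add: times_mps_def sum_distrib_right sum.Sigma finite_atMost_index)
    also have "\<dots> = (\<Sum>(b, c)\<in>(SIGMA b:{..n}. {..n - b}).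
        mps_nth f b * (mps_nth g c * mps_nth h (n - b - c)))"
    proof (rule sum.reindex_bij_witness
        [where i = "\<lambda>(b, c). (\<lambda>i. b i + c i, b)" and j = "\<lambda>(a, b). (b, a - b)"])
      fix x assume "x \<in> (SIGMA a:{..n}. {..a})"
      then obtain a b where x: "x = (a, b)" and le: "a \<le> n" "b \<le> a" by auto
      have "n - b - (a - b) = n - a" using le by (fastforce simp: le_fun_def)
      then show "(case case x of (a, b) \<Rightarrow> (b, a - b) of
            (b, c) \<Rightarrow> mps_nth f b * (mps_nth g c * mps_nth h (n - b - c))) =
          (case x of (a, b) \<Rightarrow> mps_nth f b * mps_nth g (a - b) * mps_nth h (n - a))"
        by (simp add: x mult.assoc)
      show "(case case x of (a, b) \<Rightarrow> (b, a - b) of (b, c) \<Rightarrow> (\<lambda>i. b i + c i, b)) = x"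
        using le by (auto simp: x le_fun_def)
      show "(case x of (a, b) \<Rightarrow> (b, a - b)) \<in> (SIGMA b:{..n}. {..n - b})"
        using le by (auto simp: x le_fun_def intro: order_trans diff_le_mono)
    next
      fix y assume "y \<in> (SIGMA b:{..n}. {..n - b})"
      then obtain b c where y: "y = (b, c)" and le: "b \<le> n" "c \<le> n - b" by auto
      show "(case case y of (b, c) \<Rightarrow> (\<lambda>i. b i + c i, b) of (a, b) \<Rightarrow> (b, a - b)) = y"
        by (auto simp: y)
      have "b i + c i \<le> n i" for i
        using le(1)[THEN le_funD, of i] le(2)[THEN le_funD, of i] by auto
      then show "(case y of (b, c) \<Rightarrow> (\<lambda>i. b i + c i, b)) \<in> (SIGMA a:{..n}. {..a})"
        by (auto simp: y le_fun_def)
    qed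
    also have "\<dots> = mps_nth (f * (g * h)) n"
      by (simp add: times_mps_def sum_distrib_left sum.Sigma finite_atMost_index)
    finally show "mps_nth (f * g * h) n = mps_nth (f * (g * h)) n" .
  qed
  show "f * g = g * f"
  proof (rule mps_ext)
    fix n :: "'a \<Rightarrow> nat"
    show "mps_nth (f * g) n = mps_nth (g * f) n"
      unfolding times_mps_def mps_nth_Abs
    proof (rule sum.reindex_bij_witness[where i = "\<lambda>a. n - a" and j = "\<lambda>a. n - a"])
      fix a assume "a \<in> {..n}"
      then have "n - (n - a) = a" by (auto simp: le_fun_def)
      then show "n - (n - a) = a" "n - (n - a) = a"
        "mps_nth g (n - a) * mps_nth f (n - (n - a)) = mps_nth f a * mps_nth g (n - a)"
        by (simp_all add: mult.commute)
    qed (auto simp: le_fun_def)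
  qed
  show "1 * f = f"
  proof (rule mps_ext)
    fix n :: "'a \<Rightarrow> nat"
    have "mps_nth (1 * f) n = (\<Sum>a\<in>{..n}. if a = (\<lambda>_. 0) then mps_nth f n else 0)"
      by (auto simp: times_mps_def one_mps_def fun_diff_def intro!: sum.cong)
    also have "\<dots> = mps_nth f n"
      by (auto simp: finite_atMost_index le_fun_def)
    finally show "mps_nth (1 * f) n = mps_nth f n" .
  qed
  show "(f + g) * h = f * h + g * h"
    by (rule mps_ext) (simp add: times_mps_def plus_mps_def distrib_right sum.distrib)
  show "(0::('a, 'b) mps) \<noteq> 1"
  proof
    assume "(0::('a, 'b) mps) = 1"
    then have "mps_nth (0::('a, 'b) mps) (\<lambda>_. 0) = mps_nth 1 (\<lambda>_. 0)" by simp
    then show False by (simp add: zero_mps_def one_mps_def)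
  qed
qed (auto intro!: mps_ext
      simp: plus_mps_def zero_mps_def uminus_mps_def minus_mps_def algebra_simps)

end

definition mps_const :: "'a::zero \<Rightarrow> ('v, 'a) mps" where
  "mps_const c = Abs_mps (\<lambda>n. if n = (\<lambda>_. 0) then c else 0)"

definition mps_var :: "'v \<Rightarrow> ('v, 'a::zero_neq_one) mps" where
  "mps_var v = Abs_mps (\<lambda>n. if n = (\<lambda>_. 0)(v := 1) then 1 else 0)"

text \<open>
  Substitution \<open>f(g)\<close>, meaningful when every \<open>g v\<close> has constant term zero: then
  \<open>\<Prod>v. g v ^ j v\<close> has no terms of total degree below \<open>mdeg j\<close>, so that only indices
  with \<open>mdeg j \<le> mdeg n\<close> contribute to the coefficient at \<open>n\<close>.
\<close>
definition mps_subst ::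
    "('v::finite, 'a::comm_ring_1) mps \<Rightarrow> ('v \<Rightarrow> ('w::finite, 'a) mps) \<Rightarrow> ('w, 'a) mps" where
  "mps_subst f g = Abs_mps (\<lambda>n.
     \<Sum>j | mdeg j \<le> mdeg n. mps_nth f j * mps_nth (\<Prod>v\<in>UNIV. g v ^ j v) n)"


section \<open>Finite extensions of the p-adic numbers\<close>

text \<open>
  The absolute value is read off from the metric; \<open>padic_field\<close> requires that the metric
  is the one induced by it.
\<close>
definition vabs :: "'a::{zero, metric_space} \<Rightarrow> real" where
  "vabs x = dist x 0"

definition valuation_ring :: "'a::{zero, metric_space} set" where
  "valuation_ring = {x. vabs x \<le> 1}"

text \<open>
  In a non-archimedean field with \<open>|p| = 1/p\<close> the absolute value restricts to the p-adic
  one on the rationals. Hence, if the closure of the rationals is complete, it is the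
  completion of the rationals for the p-adic absolute value, that is, the field of p-adic
  numbers, and \<open>K\<close> is finite over it iff it is spanned by a finite set.
\<close>
definition padic_field :: "nat \<Rightarrow> 'a::{field_char_0, metric_space} itself \<Rightarrow> bool" where
  "padic_field p K \<longleftrightarrow>
     (\<forall>x y :: 'a. dist x y = vabs (x - y)) \<and>
     (\<forall>x y :: 'a. vabs (x * y) = vabs x * vabs y) \<and>
     (\<forall>x y :: 'a. vabs (x + y) \<le> max (vabs x) (vabs y)) \<and>
     vabs (of_nat p :: 'a) = 1 / real p \<and>
     complete (closure \<rat> :: 'a set) \<and>
     (\<exists>B :: 'a set. finite B \<and>
        (\<forall>x. \<exists>c. (\<forall>b\<in>B. c b \<in> closure \<rat>) \<and> x = (\<Sum>b\<in>B. c b * b)))"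


section \<open>Formal group laws\<close>

text \<open>
  An \<open>m\<close>-dimensional law is a family \<open>G\<close> indexed by a finite type \<open>'m\<close> with \<open>m\<close> elements;
  the variables of \<open>G j\<close> are \<open>X\<^sub>i\<close> (written \<open>Inl i\<close>) and \<open>Y\<^sub>i\<close> (written \<open>Inr i\<close>).
\<close>
definition law_app ::
    "('m::finite \<Rightarrow> ('m + 'm, 'a::comm_ring_1) mps) \<Rightarrow>
     ('m \<Rightarrow> ('w::finite, 'a) mps) \<Rightarrow> ('m \<Rightarrow> ('w, 'a) mps) \<Rightarrow> 'm \<Rightarrow> ('w, 'a) mps" where
  "law_app G A B = (\<lambda>j. mps_subst (G j) (case_sum A B))"

definition formal_group_law ::
    "('m::finite \<Rightarrow> ('m + 'm, 'a::{field_char_0, metric_space}) mps) \<Rightarrow> bool" where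
  "formal_group_law G \<longleftrightarrow>
     (\<forall>j n. mps_nth (G j) n \<in> valuation_ring) \<and>
     (\<exists>\<gamma>. \<forall>j n. mdeg n \<le> 2 \<longrightarrow>
        mps_nth (G j) n =
        mps_nth (mps_var (Inl j) + mps_var (Inr j) +
          (\<Sum>l\<in>UNIV. \<Sum>k\<in>UNIV. mps_const (\<gamma> j l k) * mps_var (Inl l) * mps_var (Inr k))) n) \<and>
     (let X = (\<lambda>i. mps_var (Inl i)) :: 'm \<Rightarrow> ('m + 'm + 'm, 'a) mps;
          Y = (\<lambda>i. mps_var (Inr (Inl i)));
          Z = (\<lambda>i. mps_var (Inr (Inr i)))
      in law_app G (law_app G X Y) Z = law_app G X (law_app G Y Z))"


section \<open>Rings of functions\<close>

text \<open>
  All rings are regarded inside \<open>K[[t]]\<close>. The rings \<open>R[[p\<^sup>-\<^sup>k t]]\<close> (the ring of functions of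
  \<open>G\<^sub>k\<close>), the convergent functions on the standard group of level \<open>k\<close> to \<open>G\<close>, and the
  modified ring of functions of \<open>G\<^sub>h\<close> depend on \<open>G\<close> only through its dimension, hence take
  no argument \<open>G\<close>. The levels are real numbers.
\<close>
definition function_ring ::
    "nat \<Rightarrow> real \<Rightarrow> ('m::finite, 'a::{zero, metric_space}) mps set" where
  "function_ring p k =
     {f. \<forall>j. vabs (mps_nth f j) * real p powr (- k * real (mdeg j)) \<le> 1}"

definition max_norm :: "('m::finite \<Rightarrow> 'a::{zero, metric_space}) \<Rightarrow> real" where
  "max_norm z = (MAX i. vabs (z i))"

definition converges_at ::
    "('m::finite, 'a::{field, metric_space}) mps \<Rightarrow> ('m \<Rightarrow> 'a) \<Rightarrow> bool" where
  "converges_at f z \<longleftrightarrow> (\<lambda>j. mps_nth f j * (\<Prod>i\<in>UNIV. z i ^ j i)) summable_on UNIV"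

definition convergent_functions ::
    "nat \<Rightarrow> real \<Rightarrow> ('m::finite, 'a::{field, metric_space}) mps set" where
  "convergent_functions p k =
     {f \<in> function_ring p k. \<forall>z. max_norm z \<le> real p powr (- k) \<longrightarrow> converges_at f z}"

definition mfact :: "('m::finite \<Rightarrow> nat) \<Rightarrow> nat" where
  "mfact j = (\<Prod>i\<in>UNIV. fact (j i))"

text \<open>
  With \<open>c\<^sub>j = b\<^sub>j p\<^sup>-\<^sup>h\<^sup>|\<^sup>j\<^sup>|\<close> the coefficient of \<open>t\<^sup>j\<close>, the condition \<open>j! b\<^sub>j \<in> R\<close> becomes the
  following one, which makes sense also if \<open>K\<close> contains no power \<open>p\<^sup>h\<close>.
\<close>
definition modified_function_ring ::
    "nat \<Rightarrow> real \<Rightarrow> ('m::finite, 'a::{field, metric_space}) mps set" where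
  "modified_function_ring p h =
     {f. \<forall>j. vabs (of_nat (mfact j) * mps_nth f j) * real p powr (- h * real (mdeg j)) \<le> 1}"

end

theory Submission imports Defs begin

text \<open>
  The \<open>p\<close>-adic absolute value of \<open>n!\<close> is at least \<open>p\<^bsup>-n/(p-1)\<^esup>\<close>, so at a point of norm at most
  \<open>p\<^bsup>-k\<^esup>\<close> the term of index \<open>j\<close> of a series in the modified ring is at most \<open>p\<^bsup>-(k-k\<^sub>0)|j|\<^esup>\<close>.
  The terms thus tend to zero, which suffices for convergence, since an ultrametric field
  that is finite over a complete subfield is complete.
\<close>

section \<open>Ultrametric fields\<close>

text \<open>The locale isolates the ultrametric axioms in \<open>padic_field\<close>. Completeness
  and the value at \<open>p\<close> enter as separate hypotheses where a result uses them.\<close>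

locale ultrametric_field =
  fixes K :: "'a::{field, metric_space} itself"
  assumes dist_eq: "dist (x::'a) y = vabs (x - y)"
    and vabs_mult: "vabs (x * y :: 'a) = vabs x * vabs y"
    and vabs_add: "vabs (x + y :: 'a) \<le> max (vabs x) (vabs y)"
begin

lemma vabs_nonneg [simp]: "0 \<le> vabs (x::'a)"
  by (simp add: vabs_def)

lemma vabs_zero [simp]: "vabs (0::'a) = 0"
  by (simp add: vabs_def)

lemma vabs_eq_0_iff [simp]: "vabs (x::'a) = 0 \<longleftrightarrow> x = 0"
  by (simp add: vabs_def)

lemma vabs_pos_iff [simp]: "0 < vabs (x::'a) \<longleftrightarrow> x \<noteq> 0"
  by (simp add: vabs_def)

lemma vabs_one [simp]: "vabs (1::'a) = 1"
  using vabs_mult[of 1 1] vabs_eq_0_iff[of 1] by simp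

lemma vabs_minus_commute: "vabs (x - y :: 'a) = vabs (y - x)"
  by (metis dist_commute dist_eq)

lemma vabs_uminus [simp]: "vabs (- x :: 'a) = vabs x"
  using vabs_minus_commute[of 0 x] by simp

lemma vabs_diff: "vabs (x - y :: 'a) \<le> max (vabs x) (vabs y)"
  using vabs_add[of x "- y"] by simp

lemma vabs_inverse: "vabs (inverse x :: 'a) = inverse (vabs x)"
proof (cases "x = 0")
  case False
  then have "vabs x * vabs (inverse x) = 1"
    by (metis vabs_mult right_inverse vabs_one)
  then show ?thesis by (metis inverse_unique)
qed simp

lemma vabs_power: "vabs (x ^ n :: 'a) = vabs x ^ n"
  by (induction n) (simp_all add: vabs_mult)

lemma vabs_prod: "vabs (\<Prod>i\<in>A. f i :: 'a) = (\<Prod>i\<in>A. vabs (f i))"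
  by (induction A rule: infinite_finite_induct) (simp_all add: vabs_mult)

lemma vabs_sum_le:
  assumes "0 \<le> M" "\<And>i. i \<in> A \<Longrightarrow> vabs (f i :: 'a) \<le> M"
  shows "vabs (\<Sum>i\<in>A. f i) \<le> M"
  using assms(2)
proof (induction A rule: infinite_finite_induct)
  case (insert i A)
  then show ?case using vabs_add[of "f i" "sum f A"] by fastforce
qed (simp_all add: assms(1))

lemma vabs_of_nat_le_1: "vabs (of_nat n :: 'a) \<le> 1"
proof (induction n)
  case (Suc n)
  then show ?case using vabs_add[of 1 "of_nat n"] by simp
qed simp

lemma vabs_of_int_le_1: "vabs (of_int n :: 'a) \<le> 1"
  by (cases n rule: int_cases2) (simp_all add: vabs_of_nat_le_1)

text \<open>By the ultrametric inequality a finite sum is no larger than its largest term. Hence the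
  sums over the finite sets of non-small terms form a Cauchy sequence, and its limit is the
  unordered sum.\<close>

lemma summable_on_if_vanishing:
  fixes f :: "'b \<Rightarrow> 'a"
  assumes "complete (UNIV :: 'a set)"
    and fin: "\<And>e. 0 < e \<Longrightarrow> finite {i. e \<le> vabs (f i)}"
  shows "f summable_on UNIV"
proof -
  define S where "S n = {i. inverse (real (Suc n)) \<le> vabs (f i)}" for n
  have finS: "finite (S n)" for n unfolding S_def by (rule fin) simp
  \<comment> \<open>The terms added in passing from \<open>S n\<close> to a larger finite set are
    all below \<open>inverse (real (Suc n))\<close>, and so is their sum, however many there
    are.\<close>
  have tail: "dist (sum f A) (sum f (S n)) \<le> inverse (real (Suc n))"
    if "finite A" "S n \<subseteq> A" for A n
  proof -
    have "sum f A - sum f (S n) = sum f (A - S n)"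
      using that by (simp add: sum_diff)
    moreover have "vabs (sum f (A - S n)) \<le> inverse (real (Suc n))"
      by (rule vabs_sum_le) (auto simp: S_def)
    ultimately show ?thesis by (simp add: dist_eq)
  qed
  have mono: "S n \<subseteq> S m" if "n \<le> m" for n m
  proof -
    have "inverse (real (Suc m)) \<le> inverse (real (Suc n))"
      using that by (intro le_imp_inverse_le) auto
    then show ?thesis unfolding S_def using order_trans by blast
  qed
  have "Cauchy (\<lambda>n. sum f (S n))"
    unfolding Cauchy_altdef2
  proof (intro allI impI)
    fix e :: real assume "0 < e"
    then obtain N where "inverse (real (Suc N)) < e" using reals_Archimedean by blast
    then show "\<exists>N. \<forall>n\<ge>N. dist (sum f (S n)) (sum f (S N)) < e"
      using tail[OF finS mono] by (meson le_less_trans)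
  qed
  then obtain l where l: "(\<lambda>n. sum f (S n)) \<longlonglongrightarrow> l"
    using assms(1) unfolding complete_def by blast
  have "(f has_sum l) UNIV"
    unfolding has_sum_def tendsto_iff eventually_finite_subsets_at_top
  proof (intro allI impI)
    fix e :: real assume e: "0 < e"
    obtain N where N: "dist (sum f (S n)) l < e / 2" if "n \<ge> N" for n
      using l e unfolding lim_sequentially by (meson half_gt_zero)
    obtain M where M: "inverse (real (Suc M)) < e / 2"
      using reals_Archimedean e half_gt_zero by blast
    \<comment> \<open>From \<open>N\<close> on, the sums over \<open>S n\<close> are within
      \<open>e / 2\<close> of the limit; from \<open>M\<close> on, enlarging \<open>S n\<close>
      changes the sum by less than \<open>e / 2\<close>.\<close>
    define n where "n = max N M"
    have n: "inverse (real (Suc n)) < e / 2"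
    proof -
      have "inverse (real (Suc n)) \<le> inverse (real (Suc M))"
        unfolding n_def by (intro le_imp_inverse_le) auto
      then show ?thesis using M by (rule le_less_trans)
    qed
    show "\<exists>X. finite X \<and> X \<subseteq> UNIV \<and>
        (\<forall>Y. finite Y \<and> X \<subseteq> Y \<and> Y \<subseteq> UNIV \<longrightarrow> dist (sum f Y) l < e)"
    proof (intro exI[of _ "S n"] conjI allI impI)
      fix Y assume "finite Y \<and> S n \<subseteq> Y \<and> Y \<subseteq> UNIV"
      then have "dist (sum f Y) (sum f (S n)) < e / 2"
        using tail[of Y n] n by simp
      moreover have "dist (sum f (S n)) l < e / 2" by (rule N) (simp add: n_def)
      ultimately show "dist (sum f Y) l < e"
        by (metis dist_triangle_half_l dist_commute)
    qed (simp_all add: finS)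
  qed
  then show ?thesis by (auto simp: summable_on_def)
qed


section \<open>Completeness of finite extensions\<close>

text \<open>A set rather than a type, because the base field will be the closure of the rationals
  inside the given field. Closure under subtraction yields zero and negatives, and
  \<open>inverse 0 = 0\<close> keeps the last clause consistent at zero.\<close>

definition subfield_set :: "'a set \<Rightarrow> bool" where
  "subfield_set F \<longleftrightarrow> 1 \<in> F \<and> (\<forall>x\<in>F. \<forall>y\<in>F. x - y \<in> F \<and> x * y \<in> F) \<and> (\<forall>x\<in>F. inverse x \<in> F)"

definition subspace_over :: "'a set \<Rightarrow> 'a set \<Rightarrow> bool" where
  "subspace_over F W \<longleftrightarrow> 0 \<in> W \<and> (\<forall>x\<in>W. \<forall>y\<in>W. x - y \<in> W) \<and> (\<forall>c\<in>F. \<forall>x\<in>W. c * x \<in> W)"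

lemma subspace_over_add:
  assumes "subspace_over F W" "x \<in> W" "y \<in> W"
  shows "x + y \<in> W"
proof -
  have "x - (0 - y) \<in> W" using assms unfolding subspace_over_def by blast
  then show ?thesis by simp
qed

lemma subspace_over_sum:
  assumes "subspace_over F W" "\<And>i. i \<in> A \<Longrightarrow> f i \<in> W"
  shows "(\<Sum>i\<in>A. f i) \<in> W"
  using assms(2)
  by (induction A rule: infinite_finite_induct)
     (use assms(1) subspace_over_add in \<open>auto simp: subspace_over_def\<close>)

text \<open>The field operations are continuous for the absolute value, so approximations from
  \<open>F\<close> to the arguments give approximations from \<open>F\<close> to the
  results.\<close>

lemma subfield_set_closure:
  assumes "subfield_set F"
  shows "subfield_set (closure F)"
  unfolding subfield_set_def
proof (intro conjI ballI)
  note F = assms[unfolded subfield_set_def]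
  show "1 \<in> closure F" using F closure_subset by blast
  fix x assume x: "x \<in> closure F"
  show "inverse x \<in> closure F"
  proof (cases "x = 0")
    case True
    then show ?thesis using x by simp
  next
    case False
    show ?thesis unfolding closure_approachable
    proof (intro allI impI)
      fix e :: real assume e: "0 < e"
      \<comment> \<open>The first bound forces \<open>q\<close> to be at least as large as
        \<open>x\<close> in absolute value. The second then makes |q - x| / |x|^2, an upper bound
        for the distance of the inverses, smaller than \<open>e\<close>.\<close>
      define d where "d = min (vabs x) (e * (vabs x)\<^sup>2)"
      have "d > 0" using False e by (simp add: d_def)
      then obtain q where q: "q \<in> F" "vabs (q - x) < d"
        using x unfolding closure_approachable dist_eq by blast
      have "q \<noteq> 0" using q by (auto simp: d_def)
      have "vabs x \<le> max (vabs q) (vabs (q - x))" using vabs_diff[of q "q - x"] by simp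
      then have le: "vabs x \<le> vabs q" using q(2) by (auto simp: d_def)
      have "inverse q - inverse x = (x - q) * (inverse q * inverse x)"
        using False \<open>q \<noteq> 0\<close> by (simp add: field_simps)
      then have "dist (inverse q) (inverse x) = vabs (q - x) * inverse (vabs q) * inverse (vabs x)"
        using vabs_minus_commute[of q x] by (simp add: dist_eq vabs_mult vabs_inverse)
      also have "\<dots> \<le> vabs (q - x) * inverse (vabs x) * inverse (vabs x)"
        using le False by (intro mult_right_mono mult_left_mono le_imp_inverse_le) auto
      also have "\<dots> < e"
        using q(2) False by (simp add: d_def field_simps power2_eq_square)
      finally show "\<exists>y\<in>F. dist y (inverse x) < e" using F q(1) by blast
    qed
  qed
  fix y assume y: "y \<in> closure F"
  show "x - y \<in> closure F" unfolding closure_approachable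
  proof (intro allI impI)
    fix e :: real assume e: "0 < e"
    obtain q r where qr: "q \<in> F" "vabs (q - x) < e" "r \<in> F" "vabs (r - y) < e"
      using x y e unfolding closure_approachable dist_eq by meson
    have "dist (q - r) (x - y) = vabs ((q - x) - (r - y))"
      by (simp add: dist_eq algebra_simps)
    also have "\<dots> < e" using vabs_diff[of "q - x" "r - y"] qr by simp
    finally show "\<exists>z\<in>F. dist z (x - y) < e" using F qr by blast
  qed
  show "x * y \<in> closure F" unfolding closure_approachable
  proof (intro allI impI)
    fix e :: real assume e: "0 < e"
    define d where "d = e / (vabs y + 1)"
    have "d > 0" using e by (simp add: d_def add_nonneg_pos)
    then obtain q where q: "q \<in> F" "vabs (q - x) < d"
      using x unfolding closure_approachable dist_eq by meson
    \<comment> \<open>\<open>r\<close> is chosen after \<open>q\<close>, so its precision may depend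
      on the size of \<open>q\<close>. Adding 1 keeps the denominators positive when
      \<open>q\<close> or \<open>y\<close> is zero.\<close>
    have "e / (vabs q + 1) > 0" using e by (simp add: add_nonneg_pos)
    then obtain r where r: "r \<in> F" "vabs (r - y) < e / (vabs q + 1)"
      using y unfolding closure_approachable dist_eq by meson
    have "dist (q * r) (x * y) = vabs (q * (r - y) + (q - x) * y)"
      by (simp add: dist_eq algebra_simps)
    also have "\<dots> \<le> max (vabs q * vabs (r - y)) (vabs (q - x) * vabs y)"
      using vabs_add[of "q * (r - y)" "(q - x) * y"] by (simp add: vabs_mult)
    also have "\<dots> < e"
    proof -
      have aux: "u * v < e" if "0 \<le> u" "0 \<le> v" "v < e / (u + 1)" for u v :: real
      proof -
        have "v * (u + 1) < e" using that by (simp add: pos_less_divide_eq)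
        then show ?thesis using that by (simp add: algebra_simps)
      qed
      show ?thesis using aux[of "vabs q" "vabs (r - y)"] aux[of "vabs y" "vabs (q - x)"] q r
        by (simp add: d_def mult.commute)
    qed
    finally show "\<exists>z\<in>F. dist z (x * y) < e" using F q r by blast
  qed
qed

text \<open>
  If \<open>b\<close> has distance \<open>\<delta> > 0\<close> from \<open>W\<close>, then \<open>|c b + w| \<ge> \<delta> |c|\<close>, so the coordinates of
  a Cauchy sequence in \<open>F b + W\<close> are Cauchy sequences.
\<close>
lemma complete_adjoin_vector:
  assumes F: "subfield_set F" "complete F"
    and W: "subspace_over F W" "complete W" and b: "b \<notin> W"
  shows "complete {c * b + w |c w. c \<in> F \<and> w \<in> W}"
proof -
  have "closed W" using W(2) by (rule complete_imp_closed)
  \<comment> \<open>The complement of the closed set \<open>W\<close> is open, so it contains a ball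
    around \<open>b\<close>; its radius serves as \<open>\<delta>\<close>.\<close>
  then obtain \<delta> where \<delta>: "\<delta> > 0" "\<And>w. w \<in> W \<Longrightarrow> \<delta> \<le> vabs (b - w)"
    using b unfolding closed_def open_dist
    by (metis ComplD ComplI dist_commute dist_eq not_le)
  \<comment> \<open>For nonzero \<open>c\<close>, taking out the factor \<open>c\<close> leaves
    \<open>b + inverse c * w\<close>, which is \<open>b\<close> minus an element of
    \<open>W\<close>.\<close>
  have bound: "\<delta> * vabs c \<le> vabs (c * b + w)" if "c \<in> F" "w \<in> W" for c w
  proof (cases "c = 0")
    case False
    have "inverse c * w \<in> W" using F W that unfolding subfield_set_def subspace_over_def by blast
    then have "0 - inverse c * w \<in> W" using W unfolding subspace_over_def by blast
    then have "\<delta> \<le> vabs (b + inverse c * w)" using \<delta>(2) by fastforce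
    then have "vabs c * \<delta> \<le> vabs c * vabs (b + inverse c * w)" by (intro mult_left_mono) auto
    also have "\<dots> = vabs (c * (b + inverse c * w))" by (simp only: vabs_mult)
    also have "c * (b + inverse c * w) = c * b + w"
      using False by (simp add: distrib_left flip: mult.assoc)
    finally show ?thesis by (simp add: mult.commute)
  qed simp
  show ?thesis unfolding complete_def
  proof (intro allI impI, elim conjE)
    fix x assume "\<forall>n. x n \<in> {c * b + w |c w. c \<in> F \<and> w \<in> W}" and x: "Cauchy x"
    then have "\<forall>n. \<exists>c w. x n = c * b + w \<and> c \<in> F \<and> w \<in> W" by blast
    then obtain c w where cw: "\<And>n. x n = c n * b + w n" "\<And>n. c n \<in> F" "\<And>n. w n \<in> W"
      by metis
    have dist_c: "\<delta> * dist (c m) (c n) \<le> dist (x m) (x n)" for m n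
    proof -
      have "c m - c n \<in> F" "w m - w n \<in> W"
        using F W cw unfolding subfield_set_def subspace_over_def by blast+
      from bound[OF this] show ?thesis by (simp add: dist_eq cw(1) algebra_simps)
    qed
    have "Cauchy c" unfolding Cauchy_def
    proof (intro allI impI)
      fix e :: real assume "0 < e"
      then have "\<delta> * e > 0" using \<delta> by simp
      then obtain M where "\<forall>m\<ge>M. \<forall>n\<ge>M. dist (x m) (x n) < \<delta> * e"
        using x unfolding Cauchy_def by blast
      then have "\<delta> * dist (c m) (c n) < \<delta> * e" if "m \<ge> M" "n \<ge> M" for m n
        using dist_c that by (meson le_less_trans)
      then show "\<exists>M. \<forall>m\<ge>M. \<forall>n\<ge>M. dist (c m) (c n) < e"
        using \<delta>(1) by (metis mult_less_cancel_left_pos)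
    qed
    then obtain c' where c': "c' \<in> F" "c \<longlonglongrightarrow> c'" using F(2) cw(2) unfolding complete_def by blast
    \<comment> \<open>With the limit of the coefficients in hand, subtracting the convergent part
      \<open>c n * b\<close> from \<open>x n\<close> shows that the components \<open>w n\<close>
      are Cauchy as well.\<close>
    have cb: "(\<lambda>n. c n * b) \<longlonglongrightarrow> c' * b" unfolding lim_sequentially
    proof (intro allI impI)
      fix e :: real assume e: "0 < e"
      then have "0 < e / (vabs b + 1)" by (simp add: add_nonneg_pos)
      then obtain N where N: "\<And>n. n \<ge> N \<Longrightarrow> vabs (c n - c') < e / (vabs b + 1)"
        using c'(2) unfolding lim_sequentially dist_eq by blast
      have "dist (c n * b) (c' * b) < e" if "n \<ge> N" for n
      proof -
        have "vabs (c n - c') * (vabs b + 1) < e"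
          using N[OF that] by (simp add: pos_less_divide_eq add_nonneg_pos)
        then have "vabs (c n - c') * vabs b < e"
          using vabs_nonneg[of "c n - c'"] by (simp add: algebra_simps del: vabs_nonneg)
        then show ?thesis by (simp add: dist_eq vabs_mult flip: left_diff_distrib)
      qed
      then show "\<exists>N. \<forall>n\<ge>N. dist (c n * b) (c' * b) < e" by blast
    qed
    have "Cauchy w" unfolding Cauchy_def
    proof (intro allI impI)
      fix e :: real assume e: "0 < e"
      obtain M where M: "\<And>m n. m \<ge> M \<Longrightarrow> n \<ge> M \<Longrightarrow> dist (x m) (x n) < e"
        using x e unfolding Cauchy_def by blast
      obtain N where N: "\<And>m n. m \<ge> N \<Longrightarrow> n \<ge> N \<Longrightarrow> dist (c m * b) (c n * b) < e"
        using LIMSEQ_imp_Cauchy[OF cb] e unfolding Cauchy_def by blast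
      have "dist (w m) (w n) < e" if "m \<ge> max M N" "n \<ge> max M N" for m n
      proof -
        have "dist (w m) (w n) = vabs ((x m - x n) - (c m * b - c n * b))"
          by (simp add: dist_eq cw(1) algebra_simps)
        also have "\<dots> \<le> max (dist (x m) (x n)) (dist (c m * b) (c n * b))"
          unfolding dist_eq by (rule vabs_diff)
        also have "\<dots> < e" using M[of m n] N[of m n] that by simp
        finally show ?thesis .
      qed
      then show "\<exists>M. \<forall>m\<ge>M. \<forall>n\<ge>M. dist (w m) (w n) < e" by blast
    qed
    then obtain w' where w': "w' \<in> W" "w \<longlonglongrightarrow> w'" using W(2) cw(3) unfolding complete_def by blast
    have "x \<longlonglongrightarrow> c' * b + w'" unfolding lim_sequentially
    proof (intro allI impI)
      fix e :: real assume e: "0 < e"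
      obtain M where M: "\<And>n. n \<ge> M \<Longrightarrow> dist (c n * b) (c' * b) < e"
        using cb e unfolding lim_sequentially by blast
      obtain N where N: "\<And>n. n \<ge> N \<Longrightarrow> dist (w n) w' < e"
        using w'(2) e unfolding lim_sequentially by blast
      have "dist (x n) (c' * b + w') < e" if "n \<ge> max M N" for n
      proof -
        have "dist (x n) (c' * b + w') = vabs ((c n * b - c' * b) + (w n - w'))"
          by (simp add: dist_eq cw(1) algebra_simps)
        also have "\<dots> \<le> max (dist (c n * b) (c' * b)) (dist (w n) w')"
          unfolding dist_eq by (rule vabs_add)
        also have "\<dots> < e" using M[of n] N[of n] that by simp
        finally show ?thesis .
      qed
      then show "\<exists>N. \<forall>n\<ge>N. dist (x n) (c' * b + w') < e" by blast
    qed
    then show "\<exists>l\<in>{c * b + w |c w. c \<in> F \<and> w \<in> W}. x \<longlonglongrightarrow> l"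
      using c'(1) w'(1) by blast
  qed
qed

lemma subspace_over_adjoin_vector:
  assumes F: "subfield_set F" and W: "subspace_over F W"
  shows "subspace_over F {c * b + w |c w. c \<in> F \<and> w \<in> W}" (is "subspace_over F ?V")
  unfolding subspace_over_def
proof (intro conjI ballI)
  have "0 \<in> F" using F unfolding subfield_set_def by (metis diff_self)
  then have "0 * b + 0 \<in> ?V" using W unfolding subspace_over_def by blast
  then show "0 \<in> ?V" by simp
next
  fix x y assume "x \<in> ?V" "y \<in> ?V"
  then obtain c w c' w' where xy: "x = c * b + w" "c \<in> F" "w \<in> W" "y = c' * b + w'" "c' \<in> F" "w' \<in> W"
    by blast
  then have "(c - c') * b + (w - w') \<in> ?V"
    using F W unfolding subfield_set_def subspace_over_def by blast
  moreover have "x - y = (c - c') * b + (w - w')" by (simp add: xy algebra_simps)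
  ultimately show "x - y \<in> ?V" by (simp only:)
next
  fix a x assume a: "a \<in> F" and "x \<in> ?V"
  then obtain c w where x: "x = c * b + w" "c \<in> F" "w \<in> W" by blast
  then have "(a * c) * b + a * w \<in> ?V"
    using F W a unfolding subfield_set_def subspace_over_def by blast
  then show "a * x \<in> ?V" by (simp only: x distrib_left mult.assoc)
qed

text \<open>Start from the zero space and adjoin the elements of \<open>B\<close> one at a time. An
  element already in the current space is skipped, since adjoining with control of coordinates
  requires positive distance from that space.\<close>

lemma complete_subspace_containing_finite:
  assumes F: "subfield_set F" "complete F" and "finite B"
  shows "\<exists>W. subspace_over F W \<and> complete W \<and> B \<subseteq> W"
  using \<open>finite B\<close>
proof induction
  case empty
  have "subspace_over F {0}" by (simp add: subspace_over_def)
  then show ?case by (intro exI[of _ "{0}"]) (simp add: compact_imp_complete)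
next
  case (insert b B)
  then obtain W where W: "subspace_over F W" "complete W" "B \<subseteq> W" by blast
  show ?case
  proof (cases "b \<in> W")
    case True
    then show ?thesis using W by blast
  next
    case False
    let ?V = "{c * b + w |c w. c \<in> F \<and> w \<in> W}"
    have in_V: "c * b + w \<in> ?V" if "c \<in> F" "w \<in> W" for c w using that by blast
    have "0 \<in> F" "1 \<in> F" "0 \<in> W"
      using F W unfolding subfield_set_def subspace_over_def by (metis diff_self)+
    then have "b \<in> ?V" "B \<subseteq> ?V"
      using in_V[of 1 0] in_V[of 0] W(3) by auto
    then show ?thesis
      using subspace_over_adjoin_vector[OF F(1) W(1)] complete_adjoin_vector[OF F W(1,2) False]
      by blast
  qed
qed

text \<open>A complete subspace that contains a finite spanning set contains all linear
  combinations, so it is the whole field.\<close>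

lemma complete_if_finite_over_complete:
  assumes F: "subfield_set F" "complete F" and "finite B"
    and span: "\<And>x. \<exists>c. (\<forall>b\<in>B. c b \<in> F) \<and> x = (\<Sum>b\<in>B. c b * b)"
  shows "complete (UNIV :: 'a set)"
proof -
  obtain W where W: "subspace_over F W" "complete W" "B \<subseteq> W"
    using complete_subspace_containing_finite assms by blast
  have "x \<in> W" for x
  proof -
    obtain c where c: "\<forall>b\<in>B. c b \<in> F" "x = (\<Sum>b\<in>B. c b * b)" using span by blast
    show ?thesis unfolding c(2)
      using W c(1) by (intro subspace_over_sum[OF W(1)]) (auto simp: subspace_over_def)
  qed
  then have "W = UNIV" by blast
  then show ?thesis using W(2) by simp
qed


section \<open>The absolute value of factorials\<close>

context
  fixes p :: nat
  assumes p: "prime p" and vabs_p: "vabs (of_nat p :: 'a) = 1 / real p"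
begin

text \<open>In a Bezout relation u p + v n = 1 the first summand has absolute value below 1, so the
  second must reach 1; as integers have absolute value at most 1, this forces |n| = 1.\<close>

lemma vabs_of_nat_eq_1:
  assumes "\<not> p dvd n"
  shows "vabs (of_nat n :: 'a) = 1"
proof -
  have "coprime (int p) (int n)"
    using assms p by (simp add: prime_imp_coprime)
  then obtain u v where "u * int p + v * int n = 1"
    by (metis bezout_int coprime_imp_gcd_eq_1)
  then have "(1::'a) = of_int u * of_nat p + of_int v * of_nat n"
    by (metis of_int_1 of_int_add of_int_mult of_int_of_nat_eq)
  then have "1 \<le> max (vabs (of_int u * of_nat p :: 'a)) (vabs (of_int v * of_nat n :: 'a))"
    using vabs_add[of "of_int u * of_nat p" "of_int v * of_nat n"] by simp
  moreover have "vabs (of_int u * of_nat p :: 'a) < 1"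
  proof -
    have "vabs (of_int u * of_nat p :: 'a) \<le> 1 * (1 / real p)"
      unfolding vabs_mult vabs_p by (intro mult_right_mono vabs_of_int_le_1) auto
    also have "\<dots> < 1" using prime_gt_1_nat[OF p] by simp
    finally show ?thesis .
  qed
  moreover have "vabs (of_int v * of_nat n :: 'a) \<le> 1 * vabs (of_nat n :: 'a)"
    unfolding vabs_mult by (intro mult_right_mono vabs_of_int_le_1) auto
  ultimately show ?thesis using vabs_of_nat_le_1[of n] by simp
qed

text \<open>The factors from p q + 1 to p q + r are prime to \<open>p\<close>, hence of absolute
  value 1.\<close>

lemma vabs_fact_add_less:
  "r < p \<Longrightarrow> vabs (of_nat (fact (p * q + r)) :: 'a) = vabs (of_nat (fact (p * q)) :: 'a)"
proof (induction r)
  case (Suc r)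
  have "\<not> p dvd Suc r" using Suc.prems by (auto dest: dvd_imp_le)
  then have "\<not> p dvd p * q + Suc r" by (simp only: dvd_add_right_iff[OF dvd_triv_left] not_False_eq_True)
  from vabs_of_nat_eq_1[OF this]
  have "vabs (of_nat (fact (p * q + Suc r)) :: 'a) = vabs (of_nat (fact (p * q + r)) :: 'a)"
    by (simp only: add_Suc_right fact_Suc of_nat_mult of_nat_id vabs_mult mult_1)
  then show ?case using Suc by simp
qed simp

text \<open>Each block of \<open>p\<close> consecutive factors contributes exactly one multiple of
  \<open>p\<close>; extracting \<open>p\<close> from these multiples leaves the factors of
  q!.\<close>

lemma vabs_fact_mult:
  "vabs (of_nat (fact (p * q)) :: 'a) = (1 / real p) ^ q * vabs (of_nat (fact q) :: 'a)"
proof (induction q)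
  case (Suc q)
  \<comment> \<open>This splits off the top factor p (q + 1) of the factorial; the
    \<open>p - 1\<close> factors below it in the block are units.\<close>
  have eq: "p * Suc q = Suc (p * q + (p - 1))" using prime_gt_0_nat[OF p] by simp
  have "vabs (of_nat (fact (p * Suc q)) :: 'a) =
      vabs (of_nat (p * Suc q) :: 'a) * vabs (of_nat (fact (p * q + (p - 1))) :: 'a)"
    unfolding eq fact_Suc of_nat_mult of_nat_id vabs_mult ..
  also have "\<dots> = 1 / real p * vabs (of_nat (Suc q) :: 'a) *
      ((1 / real p) ^ q * vabs (of_nat (fact q) :: 'a))"
    using prime_gt_0_nat[OF p] by (simp only: vabs_fact_add_less Suc.IH of_nat_mult vabs_mult vabs_p)
  also have "\<dots> = (1 / real p) ^ Suc q * vabs (of_nat (fact (Suc q)) :: 'a)"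
    by (simp only: fact_Suc of_nat_mult of_nat_id vabs_mult power_Suc mult_ac)
  finally show ?case .
qed simp

text \<open>A recursive form of Legendre's formula: with q = n div p one has |n!| = p^(-q) |q!|,
  which allows strong induction.\<close>

lemma vabs_fact_ge: "real p powr (- real n / (real p - 1)) \<le> vabs (of_nat (fact n) :: 'a)"
proof (induction n rule: less_induct)
  case (less n)
  have p1: "real p > 1" using prime_gt_1_nat[OF p] by simp
  show ?case
  proof (cases "n = 0")
    case False
    define q r where "q = n div p" and "r = n mod p"
    have n: "n = p * q + r" and r: "r < p" using prime_gt_0_nat[OF p] by (simp_all add: q_def r_def)
    have "q < n" unfolding q_def using False prime_gt_1_nat[OF p] by simp
    \<comment> \<open>The exponents fit because q + q/(p-1) = p q/(p-1), which is at most
      n/(p-1).\<close>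
    have "real p powr (- real n / (real p - 1)) \<le> real p powr (- real q + - real q / (real p - 1))"
    proof (rule powr_mono)
      have "- real q + - real q / (real p - 1) = - (real p * real q) / (real p - 1)"
        using p1 by (simp add: field_simps)
      moreover have "- real n / (real p - 1) \<le> - (real p * real q) / (real p - 1)"
        using p1 by (intro divide_right_mono) (simp_all add: n)
      ultimately show "- real n / (real p - 1) \<le> - real q + - real q / (real p - 1)" by simp
    qed (use p1 in simp)
    also have "\<dots> = (1 / real p) ^ q * real p powr (- real q / (real p - 1))"
      using p1 by (simp only: powr_add) (simp add: powr_minus powr_realpow power_one_over inverse_eq_divide)
    also have "\<dots> \<le> (1 / real p) ^ q * vabs (of_nat (fact q) :: 'a)"
      using less.IH[OF \<open>q < n\<close>] by (intro mult_left_mono) auto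
    also have "\<dots> = vabs (of_nat (fact n) :: 'a)"
      by (simp only: n vabs_fact_add_less[OF r] vabs_fact_mult)
    finally show ?thesis .
  qed (use p1 in simp)
qed

lemma vabs_mfact_ge:
  "real p powr (- real (mdeg j) / (real p - 1)) \<le> vabs (of_nat (mfact j) :: 'a)"
proof -
  have "real p powr (- real (mdeg j) / (real p - 1)) =
      real p powr (\<Sum>i\<in>UNIV. - real (j i) / (real p - 1))"
    by (simp add: mdeg_def sum_negf flip: sum_divide_distrib)
  also have "\<dots> = (\<Prod>i\<in>UNIV. real p powr (- real (j i) / (real p - 1)))"
    using prime_gt_0_nat[OF p] by (intro powr_sum) auto
  also have "\<dots> \<le> (\<Prod>i\<in>UNIV. vabs (of_nat (fact (j i)) :: 'a))"
    by (intro prod_mono conjI vabs_fact_ge) auto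
  also have "\<dots> = vabs (of_nat (mfact j) :: 'a)"
    by (simp add: mfact_def vabs_prod)
  finally show ?thesis .
qed

section \<open>Coefficient bounds and convergence on the polydisc\<close>

text \<open>Membership bounds |j! c_j|, and the lower bound for |j!| turns this into a bound for
  |c_j| at the cost of 1/(p-1) per degree. This is where the threshold h + 1/(p-1) comes
  from.\<close>

lemma modified_function_ring_coeff_le:
  fixes f :: "('m::finite, 'a) mps"
  assumes "f \<in> modified_function_ring p h"
  shows "vabs (mps_nth f j) * real p powr (- k * real (mdeg j))
    \<le> real p powr (- (k - (h + 1 / (real p - 1))) * real (mdeg j))"
proof -
  let ?d = "real (mdeg j)"
  have p0: "real p > 0" using prime_gt_0_nat[OF p] by simp
  have "real p powr (- ?d / (real p - 1)) * vabs (mps_nth f j) * real p powr (- h * ?d)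
      \<le> vabs (of_nat (mfact j) :: 'a) * vabs (mps_nth f j) * real p powr (- h * ?d)"
    by (intro mult_right_mono vabs_mfact_ge) auto
  also have "\<dots> \<le> 1"
    using assms unfolding modified_function_ring_def by (simp add: vabs_mult)
  \<comment> \<open>Multiplying by the desired right-hand side makes the exponents on the left add
    up to \<open>- k * real (mdeg j)\<close>.\<close>
  finally have "real p powr (- ?d / (real p - 1)) * vabs (mps_nth f j) * real p powr (- h * ?d)
      * real p powr (- (k - (h + 1 / (real p - 1))) * ?d)
      \<le> 1 * real p powr (- (k - (h + 1 / (real p - 1))) * ?d)"
    by (intro mult_right_mono) auto
  also have "real p powr (- ?d / (real p - 1)) * vabs (mps_nth f j) * real p powr (- h * ?d)
      * real p powr (- (k - (h + 1 / (real p - 1))) * ?d)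
      = vabs (mps_nth f j) *
        real p powr (- ?d / (real p - 1) + - h * ?d + - (k - (h + 1 / (real p - 1))) * ?d)"
    by (simp only: powr_add mult_ac)
  also have "- ?d / (real p - 1) + - h * ?d + - (k - (h + 1 / (real p - 1))) * ?d = - k * ?d"
    by (simp add: algebra_simps)
  finally show ?thesis by simp
qed

text \<open>With \<open>s\<close> the excess of \<open>k\<close> over the threshold, the term of
  degree d is at most p^(-s d) on the polydisc. This gives the integrality condition at once, and
  convergence because only finitely many indices have bounded degree.\<close>

lemma modified_function_ring_subset_convergent:
  assumes "complete (UNIV :: 'a set)" and k: "k > h + 1 / (real p - 1)"
  shows "(modified_function_ring p h :: ('m::finite, 'a) mps set) \<subseteq> convergent_functions p k"
proof
  fix f :: "('m, 'a) mps" assume f: "f \<in> modified_function_ring p h"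
  define s where "s = k - (h + 1 / (real p - 1))"
  have s: "s > 0" using k by (simp add: s_def)
  have p1: "real p > 1" using prime_gt_1_nat[OF p] by simp
  note coeff = modified_function_ring_coeff_le[OF f, of _ k, folded s_def]
  have "vabs (mps_nth f j) * real p powr (- k * real (mdeg j)) \<le> 1" for j
  proof -
    have "real p powr (- s * real (mdeg j)) \<le> real p powr 0"
      using p1 s by (intro powr_mono) auto
    then show ?thesis using coeff[of j] p1 by simp
  qed
  then have "f \<in> function_ring p k" by (simp add: function_ring_def)
  moreover have "converges_at f z" if z: "max_norm z \<le> real p powr (- k)" for z
    unfolding converges_at_def
  proof (rule summable_on_if_vanishing[OF assms(1)])
    have zi: "vabs (z i) \<le> real p powr (- k)" for i
      using z unfolding max_norm_def by (simp add: Max_le_iff)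
    have term_le: "vabs (mps_nth f j * (\<Prod>i\<in>UNIV. z i ^ j i)) \<le> (real p powr (- s)) ^ mdeg j" for j
    proof -
      have "(\<Prod>i\<in>UNIV. vabs (z i) ^ j i) \<le> (\<Prod>i\<in>UNIV. (real p powr (- k)) ^ j i)"
        by (intro prod_mono conjI power_mono zi) auto
      also have "\<dots> = (real p powr (- k)) ^ mdeg j"
        by (simp add: mdeg_def power_sum)
      also have "\<dots> = real p powr (- k * real (mdeg j))"
        using p1 by (simp add: powr_powr flip: powr_realpow)
      finally have "vabs (mps_nth f j * (\<Prod>i\<in>UNIV. z i ^ j i))
          \<le> vabs (mps_nth f j) * real p powr (- k * real (mdeg j))"
        unfolding vabs_mult vabs_prod vabs_power by (intro mult_left_mono) auto
      also have "\<dots> \<le> real p powr (- s * real (mdeg j))" by (rule coeff)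
      also have "\<dots> = (real p powr (- s)) ^ mdeg j"
        using p1 by (simp add: powr_powr flip: powr_realpow)
      finally show ?thesis .
    qed
    fix e :: real assume e: "0 < e"
    \<comment> \<open>The geometric bound falls below \<open>e\<close> from degree \<open>N\<close>
      on, so terms of size at least \<open>e\<close> have degree at most \<open>N\<close>.\<close>
    have x1: "real p powr (- s) < 1" using p1 s powr_less_mono[of "- s" 0 "real p"] by simp
    then obtain N where N: "(real p powr (- s)) ^ N < e" using real_arch_pow_inv e by blast
    have "mdeg j \<le> N" if "e \<le> vabs (mps_nth f j * (\<Prod>i\<in>UNIV. z i ^ j i))" for j
    proof (rule ccontr)
      assume "\<not> mdeg j \<le> N"
      then have "(real p powr (- s)) ^ mdeg j \<le> (real p powr (- s)) ^ N"
        using x1 by (intro power_decreasing) auto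
      then show False using N that term_le[of j] by linarith
    qed
    then show "finite {j. e \<le> vabs (mps_nth f j * (\<Prod>i\<in>UNIV. z i ^ j i))}"
      by (intro finite_subset[OF _ finite_mdeg_le[of N]]) auto
  qed
  ultimately show "f \<in> convergent_functions p k" by (simp add: convergent_functions_def)
qed

end

end

section \<open>Application to finite extensions of the p-adic numbers\<close>

text \<open>The closure of the rationals is a subfield, complete by the definition of
  \<open>padic_field\<close>, and the field is spanned by a finite set over it.\<close>

lemma padic_field_complete:
  assumes "padic_field p TYPE('a::{field_char_0, metric_space})"
  shows "complete (UNIV :: 'a set)"
proof -
  interpret ultrametric_field "TYPE('a)"
    using assms unfolding padic_field_def by unfold_locales blast+
  have "subfield_set (\<rat> :: 'a set)" by (simp add: subfield_set_def Rats_diff Rats_mult Rats_inverse)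
  from subfield_set_closure[OF this] show ?thesis
    using assms complete_if_finite_over_complete[of "closure \<rat>"] unfolding padic_field_def by metis
qed

theorem lemma5p23:
  fixes p :: nat and h k :: real
    and G :: "'m::finite \<Rightarrow> ('m + 'm, 'a::{field_char_0, metric_space}) mps"
  assumes "prime p"
    and "padic_field p TYPE('a)"
    and "formal_group_law G"
    and "0 \<le> h"
    and "0 \<le> k"
    and "k > h + 1 / (real p - 1)"
  shows "(modified_function_ring p h :: ('m, 'a) mps set) \<subseteq> convergent_functions p k"
proof -
  interpret ultrametric_field "TYPE('a)"
    using assms(2) unfolding padic_field_def by unfold_locales blast+
  have "vabs (of_nat p :: 'a) = 1 / real p"
    using assms(2) by (simp add: padic_field_def)
  from modified_function_ring_subset_convergent[OF assms(1) this padic_field_complete[OF assms(2)] assms(6)]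
  show ?thesis .
qed

end
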